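(* Let $\lambda<0$, let $n\ge3$ be an integer, let $R>0$, and suppose $v_0(R)>0$. Then there exists $t_c\in(0,\infty)$ such that $X(t_c,R)=0$ or $\Gamma(t_c,R)=0$ if and only if one of the following three conditions holds: (1) $\partial_rC(R)<0$; (2) $\partial_rC(R)=0$ and $$\frac1{v_0(R)}-\frac{\partial_rA(R)}{2}\int_R^\infty\frac{y^{-(n-2)}}{(C(R)-A(R)y^{-(n-2)})^{3/2}}dy<0;$$ (3) $0<\partial_rC(R)<\partial_rA(R)R^{-(n-2)}$ and $$\frac1{v_0(R)}+\frac12\int_R^{\left(\frac{\partial_rA(R)}{\partial_rC(R)}\right)^{\frac1{n-2}}}\frac{\partial_rC(R)-\partial_rA(R)y^{-(n-2)}}{(C(R)-A(R)y^{-(n-2)})^{3/2}}dy\le0.$$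
   Context: Data: $\rho_0\in C([0,\infty))$, $\rho_0\ge0$; $v_0\in C([0,\infty))\cap C^1((0,\infty))$ with $v_0(0)=0$. Put $m_0(r)=\int_0^r\rho_0(s)s^{n-1}ds$, $A(r)=\frac{2|\lambda|m_0(r)}{n-2}$, $C(r)=v_0(r)^2+A(r)r^{-(n-2)}$. For each $R>0$, $X(t,R)$ (the characteristic curve of the radial Euler-Poisson system) is the solution of $$X''(t,R)=-\frac{\lambda m_0(R)}{X(t,R)^{n-1}},\quad X'(0,R)=v_0(R),\quad X(0,R)=R,$$ where $'$ is the $t$-derivative, continued up to the first time (if any) at which $X$ reaches $0$; and $\Gamma(t,R)=\partial_RX(t,R)$. A necessary and sufficient condition for the existence of $t_c\in(0,\infty)$ with $X(t_c,R)=0$ or $\Gamma(t_c,R)=0$ is called a pointwise condition for finite-time breakdown (PCFB) at $R$. Convention: a divergent integral of a nonnegative function is $+\infty$, and $0\cdot\infty=0$. *)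

theory Defs
  imports "HOL-Analysis.Analysis"
begin

definition m0 :: "nat \<Rightarrow> (real \<Rightarrow> real) \<Rightarrow> real \<Rightarrow> real" where
  "m0 n \<rho>0 r = integral {0..r} (\<lambda>s. \<rho>0 s * s ^ (n - 1))"

definition A_fun :: "real \<Rightarrow> nat \<Rightarrow> (real \<Rightarrow> real) \<Rightarrow> real \<Rightarrow> real" where
  "A_fun lam n \<rho>0 r = 2 * \<bar>lam\<bar> * m0 n \<rho>0 r / (real n - 2)"

definition C_fun :: "real \<Rightarrow> nat \<Rightarrow> (real \<Rightarrow> real) \<Rightarrow> (real \<Rightarrow> real) \<Rightarrow> real \<Rightarrow> real" where
  "C_fun lam n \<rho>0 v0 r = (v0 r)\<^sup>2 + A_fun lam n \<rho>0 r / r ^ (n - 2)"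

text \<open>The curve \<open>x\<close> issuing from \<open>R\<close> lives on the closed time interval from 0 to \<open>T\<close>, where \<open>T\<close> is the
  first time at which \<open>x\<close> reaches 0 (\<open>T = \<infinity>\<close> if there is none); its values outside this
  interval are irrelevant.  The equation is imposed before \<open>T\<close>, with \<open>v\<close> in the role of the
  velocity; at time 0 the derivatives are one-sided.  At a finite \<open>T\<close> only continuity is
  required.\<close>

definition characteristic_curve ::
  "real \<Rightarrow> nat \<Rightarrow> (real \<Rightarrow> real) \<Rightarrow> (real \<Rightarrow> real) \<Rightarrow> real \<Rightarrow> ereal \<Rightarrow> (real \<Rightarrow> real) \<Rightarrow> bool" where
  "characteristic_curve lam n \<rho>0 v0 R T x \<longleftrightarrow>
     0 < T \<and>
     x 0 = R \<and>
     (\<exists>v. v 0 = v0 R \<and>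
        (\<forall>t\<ge>0. ereal t < T \<longrightarrow>
           0 < x t \<and>
           (x has_real_derivative v t) (at t within {0..}) \<and>
           (v has_real_derivative - (lam * m0 n \<rho>0 R) / x t ^ (n - 1)) (at t within {0..}))) \<and>
     continuous_on {t. 0 \<le> t \<and> ereal t \<le> T} x \<and>
     (\<forall>t. T = ereal t \<longrightarrow> x t = 0)"

end

theory Submission
  imports Defs
begin

text \<open>
  The force is repulsive, so near \<open>R\<close> the characteristics are increasing in time and never reach 0;
  energy conservation gives \<open>X' = w(r, X)\<^sup>1\<^sup>/\<^sup>2\<close> with \<open>w(r, y) = C(r) - A(r) / y\<^sup>n\<^sup>-\<^sup>2\<close>, hence
  \<open>t\<close> is the integral of \<open>w(r, y)\<^sup>-\<^sup>1\<^sup>/\<^sup>2\<close> over \<open>y\<close> from \<open>r\<close> to \<open>X(t, r)\<close>.  Differentiating this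
  identity implicitly in \<open>r\<close> yields \<open>\<Gamma>(t, R) = X'(t, R) G(X(t, R))\<close>, where
  \<open>G(x) = 1 / v\<^sub>0(R) + 1/2 \<integral> (C'(R) - A'(R) / y\<^sup>n\<^sup>-\<^sup>2) / w(R, y)\<^sup>3\<^sup>/\<^sup>2 dy\<close> over \<open>R \<le> y \<le> x\<close>.
  Breakdown therefore means that \<open>G\<close> has a zero beyond \<open>R\<close>.  As \<open>G(R) > 0\<close> and the integrand changes
  sign at most once, from negative to positive, this is decided by the behaviour of \<open>G\<close> at infinity
  or at its minimum, according to the sign of \<open>C'(R)\<close>.
\<close>

section \<open>Implicit differentiation of a travel-time identity\<close>

lemma mvt_between:
  fixes H g :: "real \<Rightarrow> real"
  assumes der: "\<And>y. y \<in> S \<Longrightarrow> (H has_real_derivative g y) (at y)"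
    and S: "is_interval S" "a \<in> S" "b \<in> S"
  obtains \<xi> where "\<xi> \<in> S" "\<bar>\<xi> - a\<bar> \<le> \<bar>b - a\<bar>" "H b - H a = (b - a) * g \<xi>"
proof -
  have mem: "y \<in> S" if "u \<in> S" "w \<in> S" "u \<le> y" "y \<le> w" for u w y
    using S(1) that unfolding is_interval_1 by blast
  consider "a < b" | "a = b" | "b < a" by linarith
  then show ?thesis
  proof cases
    case 1
    then obtain z where "a < z" "z < b" "H b - H a = (b - a) * g z"
      using MVT2[of a b H g] der mem[OF S(2,3)] by auto
    with 1 mem[OF S(2,3), of z] show ?thesis by (intro that[of z]) auto
  next
    case 2
    with S show ?thesis by (intro that[of a]) auto
  next
    case 3
    then obtain z where "b < z" "z < a" "H a - H b = (a - b) * g z"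
      using MVT2[of b a H g] der mem[OF S(3,2)] by auto
    with 3 mem[OF S(3,2), of z] show ?thesis by (intro that[of z]) (auto simp: algebra_simps)
  qed
qed

text \<open>A mean value point between \<open>\<phi> R\<close> and \<open>\<phi> r\<close> is
  squeezed to \<open>\<phi> R\<close>, and joint continuity of \<open>g\<close> gives the limit. The
  function being incremented varies with \<open>r\<close> too, so differentiability of
  \<open>H R\<close> alone would not do. The product form keeps \<open>q\<close> meaningful where
  \<open>\<phi> r = \<phi> R\<close>.\<close>

lemma partial_difference_quotient:
  fixes H g :: "real \<Rightarrow> real \<Rightarrow> real" and \<phi> :: "real \<Rightarrow> real"
  assumes U: "open U" "R \<in> U" and S: "is_interval S"
    and der: "\<And>r y. r \<in> U \<Longrightarrow> y \<in> S \<Longrightarrow> (H r has_real_derivative g r y) (at y)"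
    and cont: "continuous_on (U \<times> S) (\<lambda>(r, y). g r y)"
    and \<phi>: "\<And>r. r \<in> U \<Longrightarrow> \<phi> r \<in> S" "isCont \<phi> R"
  obtains q where "(q \<longlongrightarrow> g R (\<phi> R)) (at R)"
    "\<And>r. r \<in> U \<Longrightarrow> H r (\<phi> r) - H r (\<phi> R) = (\<phi> r - \<phi> R) * q r"
proof -
  have "\<exists>z. z \<in> S \<and> \<bar>z - \<phi> R\<bar> \<le> \<bar>\<phi> r - \<phi> R\<bar> \<and>
      H r (\<phi> r) - H r (\<phi> R) = (\<phi> r - \<phi> R) * g r z" if "r \<in> U" for r
    using mvt_between[of S "H r" "g r" "\<phi> R" "\<phi> r"] der S \<phi>(1) U that by metis
  then obtain \<xi> where \<xi>: "\<And>r. r \<in> U \<Longrightarrow> \<xi> r \<in> S"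
      "\<And>r. r \<in> U \<Longrightarrow> \<bar>\<xi> r - \<phi> R\<bar> \<le> \<bar>\<phi> r - \<phi> R\<bar>"
      "\<And>r. r \<in> U \<Longrightarrow> H r (\<phi> r) - H r (\<phi> R) = (\<phi> r - \<phi> R) * g r (\<xi> r)"
    by metis
  have ev: "\<forall>\<^sub>F r in at R. r \<in> U"
    using U by (simp add: eventually_at_in_open' )
  have "((\<lambda>r. \<phi> r - \<phi> R) \<longlongrightarrow> 0) (at R)"
    using \<phi>(2) by (simp add: isCont_def LIM_zero_iff)
  then have "((\<lambda>r. \<xi> r - \<phi> R) \<longlongrightarrow> 0) (at R)"
    by (rule Lim_transform_bound[rotated]) (use ev \<xi>(2) in \<open>auto elim!: eventually_mono\<close>)
  then have "(\<xi> \<longlongrightarrow> \<phi> R) (at R)" by (simp add: LIM_zero_iff)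
  then have "((\<lambda>r. (r, \<xi> r)) \<longlongrightarrow> (R, \<phi> R)) (at R)"
    by (intro tendsto_Pair) auto
  then have "((\<lambda>r. case (r, \<xi> r) of (r, y) \<Rightarrow> g r y) \<longlongrightarrow> (case (R, \<phi> R) of (r, y) \<Rightarrow> g r y)) (at R)"
    by (rule continuous_on_tendsto_compose[OF cont])
       (use U \<phi> \<xi> ev in \<open>auto elim!: eventually_mono\<close>)
  then show ?thesis using \<xi>(3) by (intro that[of "\<lambda>r. g r (\<xi> r)"]) auto
qed

text \<open>Continuity of \<open>\<phi>\<close> is not assumed: the lower bound on \<open>g = \<partial>H/\<partial>y\<close> supplies it.\<close>

lemma implicit_travel_time_derivative:
  fixes H g :: "real \<Rightarrow> real \<Rightarrow> real" and \<phi> :: "real \<Rightarrow> real"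
  assumes U: "open U" "R \<in> U" and S: "is_interval S" "U \<subseteq> S"
    and der: "\<And>r y. r \<in> U \<Longrightarrow> y \<in> S \<Longrightarrow> (H r has_real_derivative g r y) (at y)"
    and cont: "continuous_on (U \<times> S) (\<lambda>(r, y). g r y)"
    and c: "0 < c" "\<And>r y. r \<in> U \<Longrightarrow> y \<in> S \<Longrightarrow> c \<le> g r y"
    and \<phi>: "\<And>r. r \<in> U \<Longrightarrow> \<phi> r \<in> S"
    and D: "((\<lambda>r. H r (\<phi> R)) has_real_derivative D) (at R)"
    and D0: "((\<lambda>r. H r R) has_real_derivative D0) (at R)"
    and eq: "\<And>r. r \<in> U \<Longrightarrow> H r (\<phi> r) - H r r = t"
  shows "(\<phi> has_real_derivative (g R R + D0 - D) / g R (\<phi> R)) (at R)"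
proof -
  have ev: "\<forall>\<^sub>F r in at R. r \<in> U"
    using U by (simp add: eventually_at_in_open')
  obtain p where p: "(p \<longlongrightarrow> g R R) (at R)"
      "\<And>r. r \<in> U \<Longrightarrow> H r r - H r R = (r - R) * p r"
  proof (rule partial_difference_quotient[of U R S H g "\<lambda>r. r"])
  qed (use U S der cont in auto)
  \<comment> \<open>Subtracting \<open>eq\<close> at \<open>R\<close> from \<open>eq\<close> at
    \<open>r\<close> isolates the increment at the moving upper endpoint; each remaining term has a
    known difference quotient at \<open>R\<close>.\<close>
  have incr: "H r (\<phi> r) - H r (\<phi> R) =
      (r - R) * p r + (H r R - H R R) - (H r (\<phi> R) - H R (\<phi> R))" if "r \<in> U" for r
    using p(2)[OF that] eq[OF that] eq[OF U(2)] by linarith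
  have lim0: "((\<lambda>r. (r - R) * p r + (H r R - H R R) - (H r (\<phi> R) - H R (\<phi> R)))
      \<longlongrightarrow> (R - R) * g R R + (H R R - H R R) - (H R (\<phi> R) - H R (\<phi> R))) (at R)"
    using DERIV_isCont[OF D] DERIV_isCont[OF D0] unfolding isCont_def
    by (intro tendsto_intros p) auto
  \<comment> \<open>By the mean value theorem and \<open>c \<le> g\<close>, the increment of
    \<open>\<phi>\<close> is at most that of \<open>H r\<close> divided by \<open>c\<close>, and the
    latter tends to 0 by \<open>lim0\<close>.\<close>
  have "((\<lambda>r. \<phi> r - \<phi> R) \<longlongrightarrow> 0) (at R)"
  proof (rule Lim_null_comparison)
    show "((\<lambda>r. \<bar>(r - R) * p r + (H r R - H R R) - (H r (\<phi> R) - H R (\<phi> R))\<bar> / c) \<longlongrightarrow> 0) (at R)"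
      using tendsto_divide[OF tendsto_rabs[OF lim0] tendsto_const[of c]] c by simp
    have "norm (\<phi> r - \<phi> R) \<le> \<bar>(r - R) * p r + (H r R - H R R) - (H r (\<phi> R) - H R (\<phi> R))\<bar> / c"
      if r: "r \<in> U" for r
    proof -
      obtain \<xi> where \<xi>: "\<xi> \<in> S" "H r (\<phi> r) - H r (\<phi> R) = (\<phi> r - \<phi> R) * g r \<xi>"
        using mvt_between[OF der[OF r] S(1) \<phi>[OF U(2)] \<phi>[OF r]] by blast
      have "\<bar>\<phi> r - \<phi> R\<bar> * c \<le> \<bar>\<phi> r - \<phi> R\<bar> * g r \<xi>"
        using c(2)[OF r \<xi>(1)] by (intro mult_left_mono) auto
      also have "\<dots> = \<bar>H r (\<phi> r) - H r (\<phi> R)\<bar>"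
        using c(1) c(2)[OF r \<xi>(1)] by (simp add: \<xi>(2) abs_mult)
      finally show ?thesis using c(1) incr[OF r] by (simp add: pos_le_divide_eq)
    qed
    then show "\<forall>\<^sub>F r in at R. norm (\<phi> r - \<phi> R) \<le>
        \<bar>(r - R) * p r + (H r R - H R R) - (H r (\<phi> R) - H R (\<phi> R))\<bar> / c"
      using ev by (auto elim: eventually_mono)
  qed
  then have cont\<phi>: "isCont \<phi> R" by (simp add: isCont_def LIM_zero_iff)
  obtain q where q: "(q \<longlongrightarrow> g R (\<phi> R)) (at R)"
      "\<And>r. r \<in> U \<Longrightarrow> H r (\<phi> r) - H r (\<phi> R) = (\<phi> r - \<phi> R) * q r"
  proof (rule partial_difference_quotient[of U R S H g \<phi>])
  qed (use U S der cont \<phi> cont\<phi> in auto)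
  have gpos: "0 < g R (\<phi> R)" using c U \<phi> by (metis less_le_trans)
  have "((\<lambda>r. (p r + (H r R - H R R) / (r - R) - (H r (\<phi> R) - H R (\<phi> R)) / (r - R)) / q r)
      \<longlongrightarrow> (g R R + D0 - D) / g R (\<phi> R)) (at R)"
    using D D0 gpos unfolding has_field_derivative_iff
    by (intro tendsto_intros p q) auto
  moreover have "\<forall>\<^sub>F r in at R. (p r + (H r R - H R R) / (r - R) - (H r (\<phi> R) - H R (\<phi> R)) / (r - R)) / q r
      = (\<phi> r - \<phi> R) / (r - R)"
  proof -
    have "\<forall>\<^sub>F r in at R. 0 < q r" using order_tendstoD(1)[OF q(1) gpos] .
    moreover have "\<forall>\<^sub>F r in at R. r \<noteq> R" by (simp add: eventually_neq_at_within)
    ultimately show ?thesis using ev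
    proof eventually_elim
      case (elim r)
      have "p r + (H r R - H R R) / (r - R) - (H r (\<phi> R) - H R (\<phi> R)) / (r - R)
          = ((r - R) * p r + (H r R - H R R) - (H r (\<phi> R) - H R (\<phi> R))) / (r - R)"
        using elim by (simp add: add_divide_distrib diff_divide_distrib)
      also have "(r - R) * p r + (H r R - H R R) - (H r (\<phi> R) - H R (\<phi> R)) = (\<phi> r - \<phi> R) * q r"
        using incr[of r] q(2)[of r] elim by (simp only:)
      finally show ?case using elim by (simp only: times_divide_eq_left[symmetric]) simp
    qed
  qed
  ultimately show ?thesis
    unfolding has_field_derivative_iff by (rule Lim_transform_eventually)
qed

section \<open>Energy conservation along one characteristic\<close>

text \<open>For negative \<open>lam\<close> the acceleration is nonnegative, so the velocity never
  falls below \<open>v0 r > 0\<close> and the curve escapes at least linearly. Multiplying the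
  equation by twice the velocity and integrating yields the energy identity.\<close>

lemma characteristic_curve_energy:
  assumes cc: "characteristic_curve lam n \<rho>0 v0 r T x" and "lam < 0" "3 \<le> n"
    and "0 < r" "0 < v0 r" and m: "0 \<le> m0 n \<rho>0 r"
  obtains v where "T = \<infinity>"
    "\<And>t. 0 \<le> t \<Longrightarrow> (x has_real_derivative v t) (at t within {0..})"
    "\<And>t. 0 \<le> t \<Longrightarrow> v0 r \<le> v t" "\<And>t. 0 \<le> t \<Longrightarrow> r + v0 r * t \<le> x t"
    "\<And>t. 0 \<le> t \<Longrightarrow> (v t)\<^sup>2 = C_fun lam n \<rho>0 v0 r - A_fun lam n \<rho>0 r / x t ^ (n - 2)"
proof -
  define \<mu> where "\<mu> = - (lam * m0 n \<rho>0 r)"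
  have \<mu>: "0 \<le> \<mu>" using m \<open>lam < 0\<close> by (simp add: \<mu>_def mult_nonpos_nonneg)
  obtain v where v: "v 0 = v0 r"
      "\<And>t. 0 \<le> t \<Longrightarrow> ereal t < T \<Longrightarrow> 0 < x t"
      "\<And>t. 0 \<le> t \<Longrightarrow> ereal t < T \<Longrightarrow> (x has_real_derivative v t) (at t within {0..})"
      "\<And>t. 0 \<le> t \<Longrightarrow> ereal t < T \<Longrightarrow> (v has_real_derivative \<mu> / x t ^ (n - 1)) (at t within {0..})"
    and x: "x 0 = r" "continuous_on {t. 0 \<le> t \<and> ereal t \<le> T} x"
      "\<And>t. T = ereal t \<Longrightarrow> x t = 0" and T: "0 < T"
    using cc unfolding characteristic_curve_def \<mu>_def by blast
  have interior: "at t within {0..} = at t" if "0 < t" for t :: real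
    using that by (intro at_within_interior) (simp add: interior_real_atLeast)
  have vmono: "v0 r \<le> v t" if t: "0 \<le> t" "ereal t < T" for t
  proof -
    have lt: "ereal s < T" if "s \<le> t" for s
      using that t by (meson ereal_less_eq(3) le_less_trans)
    have "v 0 \<le> v t"
    proof (rule DERIV_nonneg_imp_increasing_open[OF t(1)])
      fix s assume s: "0 < s" "s < t"
      have "(v has_real_derivative \<mu> / x s ^ (n - 1)) (at s)"
        using v(4)[of s] lt s interior by auto
      moreover have "0 \<le> \<mu> / x s ^ (n - 1)" using v(2)[of s] lt s \<mu> by auto
      ultimately show "\<exists>y. (v has_real_derivative y) (at s) \<and> 0 \<le> y" by blast
    next
      have "(v has_real_derivative \<mu> / x s ^ (n - 1)) (at s within {0..t})" if "s \<in> {0..t}" for s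
        using v(4)[of s] lt that by (auto intro: has_field_derivative_subset)
      then show "continuous_on {0..t} v" by (rule DERIV_continuous_on)
    qed
    then show ?thesis using v(1) by simp
  qed
  \<comment> \<open>The endpoint \<open>t = T\<close> is included, although only continuity is known
    there: at a finite \<open>T\<close> this forces \<open>x T \<ge> r > 0\<close>, against
    \<open>x T = 0\<close>.\<close>
  have xmono: "x 0 \<le> x t" if t: "0 \<le> t" "ereal t \<le> T" for t
  proof (rule DERIV_nonneg_imp_increasing_open[OF t(1)])
    fix s assume s: "0 < s" "s < t"
    then have "ereal s < T" using t by (meson ereal_less(2) ereal_less_eq(3) less_ereal.simps(1) less_le_trans)
    then have "(x has_real_derivative v s) (at s)" "0 \<le> v s"
      using v(3)[of s] vmono[of s] s interior \<open>0 < v0 r\<close> by auto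
    then show "\<exists>y. (x has_real_derivative y) (at s) \<and> 0 \<le> y" by blast
  next
    show "continuous_on {0..t} x"
      by (rule continuous_on_subset[OF x(2)]) (use t in \<open>auto intro: order_trans[OF _ t(2)]\<close>)
  qed
  have Tinf: "T = \<infinity>"
  proof (cases T)
    case (real s)
    then show ?thesis using xmono[of s] x T \<open>0 < r\<close> by auto
  qed (use T in auto)
  note v = v[unfolded Tinf, simplified] and vmono = vmono[unfolded Tinf, simplified]
  have "((\<lambda>s. (v s)\<^sup>2 + 2 * \<mu> / (real n - 2) / x s ^ (n - 2)) has_real_derivative 0) (at s within {0..})"
    if s: "s \<in> {0..}" for s
  proof -
    \<comment> \<open>This substitution removes the truncated subtractions in the exponents, after
      which the kinetic and potential terms of the derivative cancel.\<close>
    obtain k where k: "n = k + 3" using \<open>3 \<le> n\<close> by (metis le_Suc_ex add.commute)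
    have "0 < x s" using v(2) s by simp
    then show ?thesis
      unfolding k using s
      by (auto intro!: derivative_eq_intros v simp: k simp del: power_Suc)
         (simp add: field_simps power2_eq_square)
  qed
  then have "\<exists>e. \<forall>s\<in>{0..}. (v s)\<^sup>2 + 2 * \<mu> / (real n - 2) / x s ^ (n - 2) = e"
    by (intro has_field_derivative_zero_constant convex_real_interval)
  then obtain e where e: "\<And>s. 0 \<le> s \<Longrightarrow> (v s)\<^sup>2 + 2 * \<mu> / (real n - 2) / x s ^ (n - 2) = e"
    by auto
  have A: "2 * \<mu> / (real n - 2) = A_fun lam n \<rho>0 r"
    using \<open>lam < 0\<close> by (simp add: \<mu>_def A_fun_def)
  have C: "e = C_fun lam n \<rho>0 v0 r"
    using e[of 0] v(1) x(1) by (simp add: A C_fun_def)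
  have low: "r + v0 r * t \<le> x t" if "0 \<le> t" for t
  proof -
    have "x 0 - v0 r * 0 \<le> x t - v0 r * t"
    proof (rule DERIV_nonneg_imp_increasing_open[OF that])
      fix s assume s: "0 < s" "s < t"
      have "((\<lambda>s. x s - v0 r * s) has_real_derivative v s - v0 r) (at s)"
        using v(3)[of s] s interior by (auto intro!: derivative_eq_intros)
      then show "\<exists>y. ((\<lambda>s. x s - v0 r * s) has_real_derivative y) (at s) \<and> 0 \<le> y"
        using vmono[of s] s by auto
    next
      show "continuous_on {0..t} (\<lambda>s. x s - v0 r * s)"
        by (intro continuous_intros continuous_on_subset[OF x(2)]) (auto simp: Tinf)
    qed
    then show ?thesis using x(1) by simp
  qed
  have "(v t)\<^sup>2 = C_fun lam n \<rho>0 v0 r - A_fun lam n \<rho>0 r / x t ^ (n - 2)" if "0 \<le> t" for t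
    using e[OF that] unfolding A C by linarith
  with Tinf v(3) vmono low show ?thesis by (intro that) auto
qed

section \<open>Travel time and differentiability of the flow in the starting radius\<close>

text \<open>Positivity of \<open>v\<close> selects the root
  \<open>w (x s) powr (-1/2) = 1 / v s\<close>, so \<open>H (x s)\<close> grows at unit rate in
  \<open>s\<close>.\<close>

lemma travel_time:
  fixes x v H :: "real \<Rightarrow> real"
  assumes x: "\<And>s. 0 \<le> s \<Longrightarrow> (x has_real_derivative v s) (at s within {0..})"
    and v: "\<And>s. 0 \<le> s \<Longrightarrow> 0 < v s" "\<And>s. 0 \<le> s \<Longrightarrow> (v s)\<^sup>2 = w (x s)"
    and H: "\<And>s. 0 \<le> s \<Longrightarrow> (H has_real_derivative w (x s) powr (-1/2)) (at (x s))"
    and "0 \<le> t"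
  shows "H (x t) - H (x 0) = t"
proof -
  have "((\<lambda>s. H (x s) - s) has_real_derivative 0) (at s within {0..})" if "s \<in> {0..}" for s
  proof -
    have s: "0 \<le> s" using that by simp
    have "w (x s) powr (-1/2) = 1 / v s"
      using v(1)[OF s] v(2)[OF s, symmetric]
      by (simp add: powr_minus_divide powr_half_sqrt)
    then have "w (x s) powr (-1/2) * v s = 1" using v(1)[OF s] by simp
    then show ?thesis
      using DERIV_diff[OF DERIV_chain2[OF H[OF s] x[OF s]] DERIV_ident] by simp
  qed
  then obtain c where "\<And>s. 0 \<le> s \<Longrightarrow> H (x s) - s = c"
    using has_field_derivative_zero_constant[of "{0..}" "\<lambda>s. H (x s) - s"]
    by (metis atLeast_iff convex_real_interval(1))
  from this[of 0] this[of t] \<open>0 \<le> t\<close> show ?thesis by simp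
qed

text \<open>This is the formula for \<open>\<Gamma>\<close>, obtained from
  \<open>implicit_travel_time_derivative\<close>. The travel-time integral \<open>H r\<close> starts
  at a fixed base point \<open>a < R\<close>, so the moving lower endpoint enters only through
  \<open>H r r\<close> and a single Leibniz rule supplies both parameter derivatives.\<close>

lemma flow_derivative:
  fixes A C dA dC :: "real \<Rightarrow> real" and x v :: "real \<Rightarrow> real \<Rightarrow> real" and k :: nat
  defines "w \<equiv> \<lambda>r y. C r - A r / y ^ k"
  assumes "0 < R" and U0: "open U\<^sub>0" "R \<in> U\<^sub>0" "U\<^sub>0 \<subseteq> {0<..}"
    and dA: "\<And>r. r \<in> U\<^sub>0 \<Longrightarrow> (A has_real_derivative dA r) (at r)" "continuous_on U\<^sub>0 dA"
    and dC: "\<And>r. r \<in> U\<^sub>0 \<Longrightarrow> (C has_real_derivative dC r) (at r)" "continuous_on U\<^sub>0 dC"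
    and A: "\<And>r. r \<in> U\<^sub>0 \<Longrightarrow> 0 \<le> A r"
    and x0: "\<And>r. r \<in> U\<^sub>0 \<Longrightarrow> x r 0 = r"
    and x: "\<And>r s. r \<in> U\<^sub>0 \<Longrightarrow> 0 \<le> s \<Longrightarrow> (x r has_real_derivative v r s) (at s within {0..})"
    and xr: "\<And>r s. r \<in> U\<^sub>0 \<Longrightarrow> 0 \<le> s \<Longrightarrow> r \<le> x r s"
    and v: "\<And>r s. r \<in> U\<^sub>0 \<Longrightarrow> 0 \<le> s \<Longrightarrow> 0 < v r s"
      "\<And>r s. r \<in> U\<^sub>0 \<Longrightarrow> 0 \<le> s \<Longrightarrow> (v r s)\<^sup>2 = w r (x r s)"
    and t: "0 \<le> t"
  shows "((\<lambda>r. x r t) has_real_derivative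
      v R t * (1 / v R 0 + 1/2 * integral {R..x R t} (\<lambda>y. (dC R - dA R / y ^ k) / w R y powr (3/2)))) (at R)"
proof -
  \<comment> \<open>Since \<open>w R\<close> is still positive slightly to the left of
    \<open>R\<close>, the base point \<open>a\<close> can be chosen there. Starting radii on both
    sides of \<open>R\<close> then lie in the open half-line \<open>{a<..}\<close>, where
    \<open>H r\<close> is differentiable.\<close>
  have "0 < w R R"
    using v[OF U0(2), of 0] x0[OF U0(2)] by (metis order_refl zero_less_power)
  moreover have "isCont (w R) R"
    unfolding w_def using \<open>0 < R\<close> by (intro continuous_intros) auto
  ultimately have "\<forall>\<^sub>F y in at_left R. 0 < w R y"
    unfolding isCont_def by (intro order_tendstoD(1)) (auto intro: tendsto_within_subset)
  moreover have "\<forall>\<^sub>F y in at_left R. y \<in> {0<..<R}"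
    using eventually_at_left_real[OF \<open>0 < R\<close>] .
  ultimately have "\<forall>\<^sub>F y in at_left R. 0 < w R y \<and> 0 < y \<and> y < R"
    by eventually_elim auto
  then obtain a where a: "0 < w R a" "0 < a" "a < R"
    using eventually_happens'[OF trivial_limit_at_left_real] by blast
  have nhds: "(A \<longlongrightarrow> A R) (nhds R)" "(C \<longlongrightarrow> C R) (nhds R)"
    using DERIV_isCont[OF dA(1)[OF U0(2)]] DERIV_isCont[OF dC(1)[OF U0(2)]]
    by (simp_all add: isCont_def tendsto_at_iff_tendsto_nhds)
  then have "((\<lambda>r. w r a) \<longlongrightarrow> w R a) (nhds R)"
    using a unfolding w_def by (intro tendsto_intros) auto
  with nhds(2) have "\<forall>\<^sub>F r in nhds R. 0 < w r a" "\<forall>\<^sub>F r in nhds R. C r < C R + 1"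
    by (auto intro: order_tendstoD a)
  moreover have "\<forall>\<^sub>F r in nhds R. r \<in> U\<^sub>0" "\<forall>\<^sub>F r in nhds R. r \<in> {a<..}"
    using U0 a by (intro eventually_nhds_in_open; simp)+
  ultimately have "\<forall>\<^sub>F r in nhds R. 0 < w r a \<and> C r < C R + 1 \<and> r \<in> U\<^sub>0 \<and> a < r"
    by eventually_elim auto
  then obtain d where d: "0 < d"
      "\<And>r. dist r R < d \<Longrightarrow> 0 < w r a \<and> C r < C R + 1 \<and> r \<in> U\<^sub>0 \<and> a < r"
    unfolding eventually_nhds_metric by blast
  \<comment> \<open>A ball is convex, as the Leibniz rule requires. On it, positivity of
    \<open>w r\<close> at \<open>a\<close> propagates to all \<open>y \<ge> a\<close>, because
    \<open>A r \<ge> 0\<close> makes \<open>w r\<close> nondecreasing; the bound on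
    \<open>C r\<close> caps \<open>w r\<close> and so bounds \<open>g\<close> from below.\<close>
  define U where "U = ball R d"
  have U: "open U" "R \<in> U" "convex U" and UU: "U \<subseteq> U\<^sub>0"
    and Ua: "\<And>r. r \<in> U \<Longrightarrow> 0 < w r a" "\<And>r. r \<in> U \<Longrightarrow> C r < C R + 1" "\<And>r. r \<in> U \<Longrightarrow> a < r"
    using d by (auto simp: U_def dist_commute)
  have wpos: "0 < w r y" if "r \<in> U" "a \<le> y" for r y
  proof -
    have "A r / y ^ k \<le> A r / a ^ k"
      using A UU a that by (intro divide_left_mono power_mono) (auto intro: mult_pos_pos)
    then show ?thesis using Ua(1)[OF that(1)] unfolding w_def by linarith
  qed
  have contc: "continuous_on (U \<times> T) (\<lambda>p. f (fst p))" if "continuous_on U\<^sub>0 f" for f :: "real \<Rightarrow> real" and T :: "real set"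
    by (rule continuous_on_compose2[OF that]) (use UU in \<open>auto intro!: continuous_intros\<close>)
  have contAC: "continuous_on U\<^sub>0 A" "continuous_on U\<^sub>0 C"
    using dA(1) dC(1) by (meson DERIV_continuous_on has_field_derivative_at_within)+
  have contw: "continuous_on (U \<times> {a..}) (\<lambda>p. w (fst p) (snd p))"
    unfolding w_def using a by (intro continuous_intros contc contAC) auto
  have contwy: "continuous_on {a..} (w r)" for r
    unfolding w_def using a by (intro continuous_intros) auto
  define g where "g = (\<lambda>r y. w r y powr (-1/2))"
  define H where "H = (\<lambda>r y. integral {a..y} (g r))"
  have contg: "continuous_on {a..} (g r)" if "r \<in> U" for r
    unfolding g_def using wpos[OF that] by (intro continuous_intros contwy) (auto simp: less_imp_neq[symmetric])
  have der: "(H r has_real_derivative g r y) (at y)" if "r \<in> U" "y \<in> {a<..}" for r y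
  proof -
    have "(H r has_real_derivative g r y) (at y within {a..y+1})"
      unfolding H_def using that by (intro integral_has_real_derivative continuous_on_subset[OF contg]) auto
    moreover have "at y within {a..y+1} = at y"
      using that by (intro at_within_interior) auto
    ultimately show ?thesis by simp
  qed
  define F where "F = (\<lambda>r y. (dC r - dA r / y ^ k) / w r y powr (3/2))"
  have contF: "continuous_on (U \<times> {a..}) (\<lambda>p. F (fst p) (snd p))"
    unfolding F_def using a wpos
    by (intro continuous_intros contc contw dA(2) dC(2)) (auto simp: less_imp_neq[symmetric])
  have contFR: "continuous_on {a..} (F R)"
    unfolding F_def using a wpos[OF U(2)]
    by (intro continuous_intros contwy) (auto simp: less_imp_neq[symmetric])
  \<comment> \<open>Used twice, with \<open>b = x R t\<close> and with \<open>b = R\<close>. The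
    factor comes from differentiating the power -1/2 in \<open>g\<close>.\<close>
  have D: "((\<lambda>r. H r b) has_real_derivative - (1/2) * integral {a..b} (F R)) (at R)" for b
  proof -
    have "((\<lambda>r. integral (cbox a b) (g r)) has_real_derivative
        integral (cbox a b) ((\<lambda>r y. - (1/2) * F r y) R)) (at R within U)"
    proof (rule leibniz_rule_field_derivative[OF _ _ _ U(2,3)])
      fix r y assume r: "r \<in> U" and y: "y \<in> cbox a b"
      have rU: "r \<in> U\<^sub>0" and wp: "0 < w r y" using r UU wpos y by auto
      have "y \<noteq> 0" using y a by auto
      have "((\<lambda>r. w r y) has_real_derivative dC r - dA r / y ^ k) (at r)"
        unfolding w_def using \<open>y \<noteq> 0\<close> by (auto intro!: derivative_eq_intros dA(1) dC(1) rU)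
      then have "((\<lambda>r. g r y) has_real_derivative - (1/2) * w r y powr (-1/2 - 1) * (dC r - dA r / y ^ k)) (at r)"
        unfolding g_def using wp by (auto intro!: derivative_eq_intros simp: powr_diff)
      also have "- (1/2) * w r y powr (-1/2 - 1) * (dC r - dA r / y ^ k) = - (1/2) * F r y"
      proof -
        have "w r y powr (-1/2 - 1) = 1 / w r y powr (3/2)"
          using powr_minus_divide[of "w r y" "3/2"] by simp
        then show ?thesis by (simp add: F_def)
      qed
      finally show "((\<lambda>r. g r y) has_real_derivative - (1/2) * F r y) (at r within U)"
        by (rule has_field_derivative_at_within)
    next
      fix r assume "r \<in> U"
      then show "g r integrable_on cbox a b"
        by (intro integrable_continuous continuous_on_subset[OF contg]) auto
    next
      show "continuous_on (U \<times> cbox a b) (\<lambda>(r, y). - (1/2) * F r y)"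
        unfolding split_beta by (intro continuous_intros continuous_on_subset[OF contF]) auto
    qed
    then show ?thesis using at_within_open[OF U(2,1)] by (simp add: H_def)
  qed
  have eq: "H r (x r t) - H r r = t" if r: "r \<in> U" for r
  proof -
    have rU: "r \<in> U\<^sub>0" using r UU by auto
    have "H r (x r t) - H r (x r 0) = t"
    proof (rule travel_time[OF x[OF rU] v(1)[OF rU] v(2)[OF rU] _ t])
      fix s :: real assume "0 \<le> s"
      then have "a < x r s" using xr[OF rU, of s] Ua(3)[OF r] by linarith
      then show "(H r has_real_derivative w r (x r s) powr (-1/2)) (at (x r s))"
        using der[OF r, of "x r s"] by (simp add: g_def)
    qed
    then show ?thesis using x0[OF rU] by simp
  qed
  have xa: "a < x r t" if "r \<in> U" for r
    using xr[of r t] t UU Ua(3)[OF that] that by fastforce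
  have CR: "0 < C R + 1"
    using a(1) A[OF U0(2)] a(2) unfolding w_def by (smt (verit) divide_nonneg_pos zero_less_power)
  \<comment> \<open>The difference of the two integrals leaves only the stretch from
    \<open>R\<close> to \<open>x R t\<close>, and dividing by \<open>g R (x R t) = 1 / v R t\<close>
    produces the factor \<open>v R t\<close>.\<close>
  have "((\<lambda>r. x r t) has_real_derivative
      (g R R + - (1/2) * integral {a..R} (F R) - - (1/2) * integral {a..x R t} (F R)) / g R (x R t)) (at R)"
  proof (rule implicit_travel_time_derivative[where c="(C R + 1) powr (-1/2)", OF U(1,2) _ _ der _ _ _ _ D D eq])
    show "continuous_on (U \<times> {a<..}) (\<lambda>(r, y). g r y)"
      unfolding g_def split_beta using wpos
      by (intro continuous_intros continuous_on_subset[OF contw]) (auto simp: less_imp_neq[symmetric])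
    fix r y assume r: "r \<in> U" and y: "y \<in> {a<..}"
    have "0 < w r y" using wpos[OF r] y by simp
    moreover have "w r y \<le> C r"
      using A[of r] UU r y a unfolding w_def by auto
    ultimately show "(C R + 1) powr (-1/2) \<le> g r y"
      unfolding g_def using Ua(2)[OF r] by (intro powr_mono2') auto
  qed (use Ua xa CR in \<open>auto simp: is_interval_1\<close>)
  moreover have "integral {a..x R t} (F R) = integral {a..R} (F R) + integral {R..x R t} (F R)"
    using xr[OF U0(2) t] a by (intro Henstock_Kurzweil_Integration.integral_combine[symmetric] integrable_continuous_real
        continuous_on_subset[OF contFR]) auto
  moreover have "g R (x R s) = 1 / v R s" if "0 \<le> s" for s
    using v(1)[OF U0(2) that]
    by (simp add: g_def powr_minus_divide powr_half_sqrt v(2)[OF U0(2) that, symmetric])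
  from this[OF t] this[of 0] have "g R R = 1 / v R 0" "g R (x R t) = 1 / v R t"
    using x0[OF U0(2)] by auto
  ultimately show ?thesis by (simp add: F_def mult.commute add_divide_distrib)
qed

section \<open>Zeros of \<open>G\<close>\<close>

text \<open>Monotone convergence over growing windows. It links the possibly infinite integral of
  the second condition with the finite integrals in \<open>G\<close>, treating convergence and
  divergence alike.\<close>

lemma nn_integral_atLeast_SUP:
  fixes h :: "real \<Rightarrow> real"
  assumes [measurable]: "h \<in> borel_measurable borel"
    and h: "continuous_on {R..} h" "\<And>y. R \<le> y \<Longrightarrow> 0 \<le> h y"
  shows "(\<integral>\<^sup>+y\<in>{R..}. ennreal (h y) \<partial>lborel) = (SUP i. ennreal (integral {R..R + real i} h))"
proof -
  define f where "f = (\<lambda>(i::nat) y. ennreal (h y) * indicator {R..R + real i} y)"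
  have integral_f: "integral\<^sup>N lborel (f i) = ennreal (integral {R..R + real i} h)" for i
  proof -
    let ?b = "R + real i"
    have "(h has_integral integral {R..?b} h) {R..?b}"
      by (intro integrable_integral integrable_continuous_real continuous_on_subset[OF h(1)]) auto
    then have "((\<lambda>y. if y \<in> {R..?b} then h y else 0) has_integral integral {R..?b} h) UNIV"
      by (simp only: has_integral_restrict_UNIV)
    moreover have "(\<lambda>y. if y \<in> {R..?b} then h y else 0) = (\<lambda>y. h y * indicator {R..?b} y)"
      by (auto split: split_indicator)
    ultimately have "((\<lambda>y. h y * indicator {R..?b} y) has_integral integral {R..?b} h) UNIV"
      by simp
    then have "(\<integral>\<^sup>+y. ennreal (h y * indicator {R..?b} y) \<partial>lborel) = ennreal (integral {R..?b} h)"
      by (intro nn_integral_has_integral_lborel) (auto simp: h(2) split: split_indicator)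
    then show ?thesis by (simp add: f_def nn_integral_set_ennreal)
  qed
  have "(\<integral>\<^sup>+y. (SUP i. f i y) \<partial>lborel) = (SUP i. integral\<^sup>N lborel (f i))"
  proof (rule nn_integral_monotone_convergence_SUP)
    show "incseq f"
      unfolding f_def by (auto simp: incseq_def le_fun_def split: split_indicator)
  qed (simp add: f_def)
  also have "(\<lambda>y. SUP i. f i y) = (\<lambda>y. ennreal (h y) * indicator {R..} y)"
  proof
    fix y
    obtain j where j: "y - R \<le> real j" using real_arch_simple by blast
    show "(SUP i. f i y) = ennreal (h y) * indicator {R..} y"
    proof (rule antisym)
      show "(SUP i. f i y) \<le> ennreal (h y) * indicator {R..} y"
        by (rule SUP_least) (auto simp: f_def split: split_indicator)
      show "ennreal (h y) * indicator {R..} y \<le> (SUP i. f i y)"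
        by (rule SUP_upper2[of j]) (use j in \<open>auto simp: f_def split: split_indicator\<close>)
    qed
  qed
  finally show ?thesis using integral_f by simp
qed

text \<open>The sign of the integrand is that of \<open>c' - a' / y ^ k\<close>, which is
  nondecreasing in \<open>y\<close>; the sign of \<open>c'\<close> and the comparison of
  \<open>c'\<close> with \<open>a' / R ^ k\<close> therefore separate all cases.\<close>

lemma breakdown_criterion:
  fixes a c a' c' R V :: real and k :: nat
  defines "w \<equiv> \<lambda>y. c - a / y ^ k"
  defines "G \<equiv> \<lambda>x. 1 / V + 1/2 * integral {R..x} (\<lambda>y. (c' - a' / y ^ k) / w y powr (3/2))"
  assumes "0 < R" "0 < V" "0 < k" "0 \<le> a" "0 \<le> a'" and wR: "0 < w R"
  shows "(\<exists>x>R. G x = 0) \<longleftrightarrow>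
      c' < 0
    \<or> (c' = 0 \<and>
         ereal (1 / V)
           - ereal (a' / 2)
             * enn2ereal (\<integral>\<^sup>+y\<in>{R..}. ennreal ((1 / y ^ k) / w y powr (3/2)) \<partial>lborel) < 0)
    \<or> (0 < c' \<and> c' < a' / R ^ k \<and> G ((a' / c') powr (1 / real k)) \<le> 0)"
proof -
  define N where "N = (\<lambda>y. (c' - a' / y ^ k) / w y powr (3/2))"
  have G: "G = (\<lambda>x. 1 / V + 1/2 * integral {R..x} N)" by (simp add: G_def N_def)
  have wpos: "0 < w y" if "R \<le> y" for y
  proof -
    have "a / y ^ k \<le> a / R ^ k"
      using \<open>0 \<le> a\<close> \<open>0 < R\<close> that by (intro divide_left_mono power_mono) (auto intro: mult_pos_pos)
    then show ?thesis using wR unfolding w_def by linarith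
  qed
  have wle: "w y \<le> c" if "R \<le> y" for y
    using \<open>0 \<le> a\<close> \<open>0 < R\<close> that by (simp add: w_def)
  have cpos: "0 < c" using wpos[of R] wle[of R] by linarith
  have contw: "continuous_on {R..} w"
    unfolding w_def using \<open>0 < R\<close> by (intro continuous_intros) auto
  have contN: "continuous_on {R..} N"
    unfolding N_def using \<open>0 < R\<close> wpos
    by (intro continuous_intros contw) (auto simp: less_imp_neq[symmetric])
  have intN: "N integrable_on {x..y}" if "R \<le> x" for x y
    by (intro integrable_continuous_real continuous_on_subset[OF contN]) (use that in auto)
  have GR: "G R = 1 / V" by (simp add: G)
  have contG: "continuous_on {R..b} G" for b
    unfolding G by (intro continuous_intros indefinite_integral_continuous_1 intN) auto
  have Gdiff: "G y = G x + 1/2 * integral {x..y} N" if "R \<le> x" "x \<le> y" for x y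
    using Henstock_Kurzweil_Integration.integral_combine[OF that intN[OF order_refl]] by (simp add: G)
  \<comment> \<open>As \<open>G R = 1 / V > 0\<close>, the intermediate value theorem turns any
    nonpositive value into a zero, so only inequalities remain to be decided.\<close>
  have zero_iff: "(\<exists>x>R. G x = 0) \<longleftrightarrow> (\<exists>x>R. G x \<le> 0)"
  proof
    assume "\<exists>x>R. G x \<le> 0"
    then obtain b where b: "R < b" "G b \<le> 0" by blast
    then obtain z where "R \<le> z" "G z = 0"
      using IVT2'[of G b 0 R] contG GR \<open>0 < V\<close> by auto
    moreover have "z \<noteq> R" using \<open>G z = 0\<close> GR \<open>0 < V\<close> by auto
    ultimately show "\<exists>x>R. G x = 0" by (intro exI[of _ z]) auto
  qed force
  have a'_le: "a' / y ^ k \<le> a' / x ^ k" if "R \<le> x" "x \<le> y" for x y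
    using \<open>0 \<le> a'\<close> \<open>0 < R\<close> that by (intro divide_left_mono power_mono) (auto intro!: mult_pos_pos)
  consider "c' < 0" | "c' = 0" | "0 < c'" "c' < a' / R ^ k" | "0 < c'" "a' / R ^ k \<le> c'"
    by linarith
  then show ?thesis
  proof cases
    case 1
    \<comment> \<open>Dropping the term with \<open>a'\<close> and using \<open>w y \<le> c\<close>
      with \<open>c' < 0\<close> bounds the integrand by \<open>- \<kappa>\<close> uniformly, so
      \<open>G\<close> decreases at least linearly.\<close>
    define \<kappa> where "\<kappa> = - c' / c powr (3/2)"
    have \<kappa>: "0 < \<kappa>" using 1 cpos by (simp add: \<kappa>_def divide_neg_pos)
    have Nle: "N y \<le> - \<kappa>" if "R \<le> y" for y
    proof -
      have "0 \<le> a' / y ^ k" using \<open>0 \<le> a'\<close> \<open>0 < R\<close> that by simp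
      then have "N y \<le> c' / w y powr (3/2)"
        unfolding N_def by (intro divide_right_mono) auto
      also have "\<dots> \<le> c' / c powr (3/2)"
        using wpos[OF that] wle[OF that] 1 cpos
        by (intro divide_left_mono_neg powr_mono2) auto
      finally show ?thesis by (simp add: \<kappa>_def)
    qed
    \<comment> \<open>Chosen so that half of \<open>- \<kappa> * (b - R)\<close> equals
      \<open>- 1 / V\<close> and cancels the initial value of \<open>G\<close>.\<close>
    define b where "b = R + 2 / (V * \<kappa>)"
    have b: "R < b" using \<open>0 < V\<close> \<kappa> by (simp add: b_def)
    have "integral {R..b} N \<le> integral {R..b} (\<lambda>y. - \<kappa>)"
      by (intro integral_le intN Nle) auto
    also have "\<dots> = - 2 / V" using b \<kappa> \<open>0 < V\<close> by (simp add: b_def)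
    finally have "G b \<le> 0" by (simp add: G)
    then show ?thesis using zero_iff b 1 by blast
  next
    case 2
    define h where "h = (\<lambda>y. (1 / y ^ k) / w y powr (3/2))"
    define I where "I = (\<lambda>x. integral {R..x} h)"
    define J where "J = (\<integral>\<^sup>+y\<in>{R..}. ennreal (h y) \<partial>lborel)"
    have conth: "continuous_on {R..} h"
      unfolding h_def using \<open>0 < R\<close> wpos
      by (intro continuous_intros contw) (auto simp: less_imp_neq[symmetric])
    have hpos: "0 < h y" if "R \<le> y" for y
      using wpos[OF that] \<open>0 < R\<close> that by (simp add: h_def)
    have inth: "h integrable_on {x..y}" if "R \<le> x" for x y
      by (intro integrable_continuous_real continuous_on_subset[OF conth]) (use that in auto)
    have I_less: "I x < I y" if "R \<le> x" "x < y" for x y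
    proof -
      have "integral {x..y} (\<lambda>_. 0) < integral {x..y} h"
        by (rule integral_less_real) (use that hpos in \<open>auto intro!: continuous_on_subset[OF conth]\<close>)
      then show ?thesis
        using Henstock_Kurzweil_Integration.integral_combine[OF that(1) less_imp_le[OF that(2)] inth[OF order_refl]]
        by (simp add: I_def)
    qed
    have J: "J = (SUP i. ennreal (I (R + real i)))"
      unfolding J_def I_def
      by (rule nn_integral_atLeast_SUP[OF _ conth less_imp_le[OF hpos]]) (simp_all add: h_def w_def)
    have "N = (\<lambda>y. - a' * h y)" by (simp add: N_def h_def 2 fun_eq_iff)
    then have GI: "G x = 1 / V - a' / 2 * I x" for x by (simp add: G I_def)
    \<comment> \<open>\<open>I\<close> increases strictly towards \<open>J\<close> without attaining
      it, so a level is reached at a finite radius exactly when it lies strictly below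
      \<open>J\<close>. Hence the strict inequality here, in contrast to the third
      condition.\<close>
    have "(\<exists>x>R. G x \<le> 0) \<longleftrightarrow> ereal (1 / V) - ereal (a' / 2) * enn2ereal J < 0"
    proof (cases "a' = 0")
      \<comment> \<open>Here \<open>G\<close> is constantly \<open>1 / V\<close>. The product with
        \<open>J\<close> is 0 even for infinite \<open>J\<close>, so both sides are false.\<close>
      case True
      then show ?thesis using GI \<open>0 < V\<close> by (auto simp: zero_ereal_def[symmetric] not_less)
    next
      case False
      then have a': "0 < a'" using \<open>0 \<le> a'\<close> by simp
      \<comment> \<open>The level at which \<open>I\<close> makes \<open>G\<close> vanish.\<close>
      define M where "M = 2 / (a' * V)"
      have M: "0 < M" "1 / V = a' / 2 * M" using a' \<open>0 < V\<close> by (simp_all add: M_def)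
      have "(\<exists>x>R. G x \<le> 0) \<longleftrightarrow> (\<exists>x>R. M \<le> I x)"
        using a' by (simp add: GI M(2))
      also have "\<dots> \<longleftrightarrow> ennreal M < J"
      proof
        assume "\<exists>x>R. M \<le> I x"
        then obtain x where x: "R < x" "M \<le> I x" by blast
        obtain i where i: "x - R < real i" using reals_Archimedean2 by blast
        have "M < I (R + real i)" using x I_less[of x "R + real i"] i by linarith
        then have "ennreal M < ennreal (I (R + real i))" using M by (simp add: ennreal_less_iff)
        also have "\<dots> \<le> J" unfolding J by (rule SUP_upper) simp
        finally show "ennreal M < J" .
      next
        assume "ennreal M < J"
        then obtain i where "ennreal M < ennreal (I (R + real i))"
          unfolding J by (auto simp: less_SUP_iff)
        then have i: "M < I (R + real i)" using M by (simp add: ennreal_less_iff)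
        moreover have "real i \<noteq> 0" using i M by (cases i) (auto simp: I_def)
        ultimately show "\<exists>x>R. M \<le> I x" by (intro exI[of _ "R + real i"]) auto
      qed
      also have "\<dots> \<longleftrightarrow> ereal (1 / V) - ereal (a' / 2) * enn2ereal J < 0"
      proof (cases J)
        case (real j)
        then show ?thesis
          using a' M by (simp add: ennreal_less_iff M(2) zero_ereal_def)
      next
        case top
        then show ?thesis using a' by (simp add: zero_ereal_def)
      qed
      finally show ?thesis .
    qed
    then show ?thesis unfolding zero_iff J_def h_def using 2 by simp
  next
    case 3
    \<comment> \<open>The radius where the integrand changes sign from negative to positive;
      \<open>c' < a' / R ^ k\<close> places it beyond \<open>R\<close>. Thus \<open>G\<close>
      attains its minimum at \<open>s\<close>, and its value there decides.\<close>
    define s where "s = (a' / c') powr (1 / real k)"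
    have "0 < R ^ k" using \<open>0 < R\<close> by simp
    then have Rk: "R ^ k < a' / c'" using 3 by (simp add: field_simps)
    then have q: "0 < a' / c'" using \<open>0 < R ^ k\<close> by linarith
    then have "0 < a'" using 3(1) by (simp add: zero_less_divide_iff)
    then have "0 < s" using 3(1) by (simp add: s_def)
    have "s ^ k = s powr real k" using \<open>0 < s\<close> by (simp add: powr_realpow)
    also have "\<dots> = a' / c'" using \<open>0 < a'\<close> 3(1) \<open>0 < k\<close> by (simp add: s_def powr_powr)
    finally have sk: "s ^ k = a' / c'" .
    have "R < s" using Rk \<open>0 < s\<close> by (intro power_less_imp_less_base[of R k]) (auto simp: sk)
    have a's: "a' / s ^ k = c'" using \<open>0 < a'\<close> 3(1) by (simp add: sk)
    have Nneg: "N y \<le> 0" if "R \<le> y" "y \<le> s" for y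
      using a'_le[OF that] a's unfolding N_def by (intro divide_nonpos_nonneg) auto
    have Npos: "0 \<le> N y" if "s \<le> y" for y
      using a'_le[OF _ that] a's \<open>R < s\<close> unfolding N_def by (intro divide_nonneg_nonneg) auto
    have "G s \<le> G x" if "R < x" for x
    proof (cases "x \<le> s")
      case True
      have "integral {x..s} N \<le> integral {x..s} (\<lambda>_. 0)"
        by (intro integral_le intN Nneg) (use that in auto)
      then show ?thesis using Gdiff[of x s] True that by simp
    next
      case False
      have "0 \<le> integral {s..x} N"
        by (intro integral_nonneg intN Npos) (use \<open>R < s\<close> in auto)
      then show ?thesis using Gdiff[of s x] False \<open>R < s\<close> by simp
    qed
    then have "(\<exists>x>R. G x \<le> 0) \<longleftrightarrow> G s \<le> 0" using \<open>R < s\<close> by (meson order_trans)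
    then show ?thesis unfolding zero_iff using 3 by (simp add: s_def)
  next
    case 4
    have "0 < G x" if "R < x" for x
    proof -
      have "0 \<le> integral {R..x} N"
      proof (intro integral_nonneg intN)
        fix y assume "y \<in> {R..x}"
        then show "0 \<le> N y"
          using a'_le[of R y] 4 unfolding N_def by (intro divide_nonneg_nonneg) auto
      qed simp
      then show ?thesis using \<open>0 < V\<close> by (simp add: G add_pos_nonneg)
    qed
    then have "\<not> (\<exists>x>R. G x = 0)" by force
    then show ?thesis using 4 by simp
  qed
qed

section \<open>Regularity of the coefficients and the breakdown theorem\<close>

lemma moment_derivative:
  assumes "continuous_on {0..} \<rho>0" "0 < r"
  shows "(m0 n \<rho>0 has_real_derivative \<rho>0 r * r ^ (n - 1)) (at r)"
proof -
  have "(m0 n \<rho>0 has_real_derivative \<rho>0 r * r ^ (n - 1)) (at r within {0..r + 1})"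
    unfolding m0_def using assms(2)
    by (intro integral_has_real_derivative continuous_intros continuous_on_subset[OF assms(1)]) auto
  moreover have "at r within {0..r + 1} = at r"
    using assms(2) by (intro at_within_interior) auto
  ultimately show ?thesis by simp
qed

lemma moment_nonneg:
  assumes "continuous_on {0..} \<rho>0" "\<And>r. 0 \<le> r \<Longrightarrow> 0 \<le> \<rho>0 r"
  shows "0 \<le> m0 n \<rho>0 r"
  unfolding m0_def
  by (intro integral_nonneg integrable_continuous_real continuous_intros
      continuous_on_subset[OF assms(1)]) (auto simp: assms(2))

theorem proposition1p8:
  fixes lam :: real and n :: nat and \<rho>0 v0 :: "real \<Rightarrow> real"
    and T :: "real \<Rightarrow> ereal" and X :: "real \<Rightarrow> real \<Rightarrow> real" and R :: real
  assumes "lam < 0" and "3 \<le> n"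
    and "continuous_on {0..} \<rho>0" and "\<And>r. 0 \<le> r \<Longrightarrow> 0 \<le> \<rho>0 r"
    and "continuous_on {0..} v0" and "v0 C1_differentiable_on {0<..}" and "v0 0 = 0"
    and "\<And>r. 0 < r \<Longrightarrow> characteristic_curve lam n \<rho>0 v0 r (T r) (\<lambda>t. X t r)"
    and "0 < R" and "0 < v0 R"
  defines "A \<equiv> A_fun lam n \<rho>0" and "C \<equiv> C_fun lam n \<rho>0 v0"
  shows "(\<exists>t\<^sub>c. 0 < t\<^sub>c \<and> ereal t\<^sub>c \<le> T R \<and>
            (X t\<^sub>c R = 0 \<or> ((\<lambda>r. X t\<^sub>c r) has_real_derivative 0) (at R)))
    \<longleftrightarrow>
      deriv C R < 0
    \<or> (deriv C R = 0 \<and>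
         ereal (1 / v0 R)
           - ereal (deriv A R / 2)
             * enn2ereal (\<integral>\<^sup>+y\<in>{R..}. ennreal ((1 / y ^ (n - 2))
                            / (C R - A R / y ^ (n - 2)) powr (3/2)) \<partial>lborel) < 0)
    \<or> (0 < deriv C R \<and> deriv C R < deriv A R / R ^ (n - 2) \<and>
         1 / v0 R
           + 1/2 * integral {R .. (deriv A R / deriv C R) powr (1 / (real n - 2))}
               (\<lambda>y. (deriv C R - deriv A R / y ^ (n - 2))
                      / (C R - A R / y ^ (n - 2)) powr (3/2)) \<le> 0)"
proof -
  define k where "k = n - 2"
  have k: "0 < k" "real n - 2 = real k" "0 < real k"
    using \<open>3 \<le> n\<close> by (auto simp: k_def)
  note \<rho>0 = assms(3,4)
  obtain v0' where v0': "\<And>r. 0 < r \<Longrightarrow> (v0 has_real_derivative v0' r) (at r)"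
      "continuous_on {0<..} v0'"
    using assms(6) unfolding C1_differentiable_on_def
    by (auto simp: has_real_derivative_iff_has_vector_derivative)
  \<comment> \<open>Explicit derivatives make their continuity in \<open>r\<close> visible, which
    differentiation under the integral sign relies on.\<close>
  define dA where "dA = (\<lambda>r. 2 * \<bar>lam\<bar> * (\<rho>0 r * r ^ (n - 1)) / real k)"
  define dC where "dC = (\<lambda>r. 2 * v0 r * v0' r + (dA r * r ^ k - A r * (real k * r ^ (k - 1))) / (r ^ k * r ^ k))"
  have dA: "(A has_real_derivative dA r) (at r)" if "0 < r" for r
    unfolding A_def A_fun_def dA_def k(2)
    using moment_derivative[OF \<rho>0(1) that, of n] k(3)
    by (auto intro!: derivative_eq_intros)
  have Ceq: "C = (\<lambda>r. (v0 r)\<^sup>2 + A r / r ^ k)"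
    by (simp add: C_def C_fun_def A_def k_def fun_eq_iff)
  have dC: "(C has_real_derivative dC r) (at r)" if "0 < r" for r
    unfolding Ceq dC_def using that
    by (auto intro!: derivative_eq_intros v0' dA)
  have contv0: "continuous_on {0<..} v0"
    by (rule continuous_on_subset[OF assms(5)]) auto
  have contA: "continuous_on {0<..} A"
    using dA by (meson DERIV_continuous_on greaterThan_iff has_field_derivative_at_within)
  have contdA: "continuous_on {0<..} dA"
    unfolding dA_def using k by (intro continuous_intros continuous_on_subset[OF \<rho>0(1)]) auto
  have contdC: "continuous_on {0<..} dC"
    unfolding dC_def by (intro continuous_intros contv0 v0'(2) contdA contA) auto
  have A0: "0 \<le> A r" for r
    unfolding A_def A_fun_def k(2) using moment_nonneg[OF \<rho>0] k(3) by simp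
  have dA0: "0 \<le> dA R"
    unfolding dA_def using \<rho>0(2) \<open>0 < R\<close> k(3) by simp
  \<comment> \<open>Differentiating in the starting radius compares neighbouring curves, so the
    energy identity must hold for all starting radii near \<open>R\<close>. Positivity of
    \<open>v0\<close> persists on an open set by continuity.\<close>
  define U where "U = {0<..} \<inter> v0 -` {0<..}"
  have U: "open U" "R \<in> U" "U \<subseteq> {0<..}"
    using continuous_open_preimage[OF contv0] \<open>0 < R\<close> \<open>0 < v0 R\<close> by (auto simp: U_def)
  have "\<forall>r\<in>U. \<exists>v. T r = \<infinity> \<and> (\<forall>t\<ge>0. ((\<lambda>t. X t r) has_real_derivative v t) (at t within {0..})
      \<and> v0 r \<le> v t \<and> r + v0 r * t \<le> X t r \<and> (v t)\<^sup>2 = C r - A r / X t r ^ k)"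
  proof
    fix r assume "r \<in> U"
    then have r: "0 < r" "0 < v0 r" by (auto simp: U_def)
    show "\<exists>v. T r = \<infinity> \<and> (\<forall>t\<ge>0. ((\<lambda>t. X t r) has_real_derivative v t) (at t within {0..})
      \<and> v0 r \<le> v t \<and> r + v0 r * t \<le> X t r \<and> (v t)\<^sup>2 = C r - A r / X t r ^ k)"
      using characteristic_curve_energy[OF assms(8)[OF r(1)] assms(1,2) r moment_nonneg[OF \<rho>0]]
      unfolding A_def C_def k_def by metis
  qed
  then obtain v where "\<forall>r\<in>U. T r = \<infinity> \<and> (\<forall>t\<ge>0. ((\<lambda>t. X t r) has_real_derivative v r t) (at t within {0..})
      \<and> v0 r \<le> v r t \<and> r + v0 r * t \<le> X t r \<and> (v r t)\<^sup>2 = C r - A r / X t r ^ k)"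
    using bchoice by metis
  then have Tinf: "\<And>r. r \<in> U \<Longrightarrow> T r = \<infinity>"
    and X: "\<And>r t. r \<in> U \<Longrightarrow> 0 \<le> t \<Longrightarrow> ((\<lambda>t. X t r) has_real_derivative v r t) (at t within {0..})"
    and vlow: "\<And>r t. r \<in> U \<Longrightarrow> 0 \<le> t \<Longrightarrow> v0 r \<le> v r t"
    and Xlow: "\<And>r t. r \<in> U \<Longrightarrow> 0 \<le> t \<Longrightarrow> r + v0 r * t \<le> X t r"
    and v2: "\<And>r t. r \<in> U \<Longrightarrow> 0 \<le> t \<Longrightarrow> (v r t)\<^sup>2 = C r - A r / X t r ^ k"
    by blast+
  have X0: "X 0 r = r" if "r \<in> U" for r
    using assms(8)[of r] that by (auto simp: U_def characteristic_curve_def)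
  have vpos: "0 < v r t" if "r \<in> U" "0 \<le> t" for r t
    using vlow[OF that] that by (auto simp: U_def)
  have Xr: "r \<le> X t r" if "r \<in> U" "0 \<le> t" for r t
  proof -
    have "0 \<le> v0 r * t" using that by (auto simp: U_def)
    then show ?thesis using Xlow[OF that] by linarith
  qed
  have wR: "C R - A R / R ^ k = (v0 R)\<^sup>2" by (simp add: Ceq)
  \<comment> \<open>At this point \<open>v\<close> is known only through
    \<open>v0 r \<le> v r t\<close> and the energy identity; the latter at time 0, with positivity,
    recovers the initial velocity.\<close>
  have v0R: "v R 0 = v0 R"
    using v2[OF U(2), of 0] X0[OF U(2)] wR vpos[OF U(2), of 0] \<open>0 < v0 R\<close>
    by (simp add: power2_eq_iff_nonneg)
  define G where "G = (\<lambda>x. 1 / v0 R + 1/2 * integral {R..x}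
      (\<lambda>y. (dC R - dA R / y ^ k) / (C R - A R / y ^ k) powr (3/2)))"
  have \<Gamma>: "((\<lambda>r. X t r) has_real_derivative v R t * G (X t R)) (at R)" if "0 \<le> t" for t
    unfolding G_def v0R[symmetric]
  proof (rule flow_derivative[where x="\<lambda>r t. X t r" and U\<^sub>0=U])
    show "continuous_on U dA" "continuous_on U dC"
      using contdA contdC U(3) continuous_on_subset by blast+
  qed (use \<open>0 < R\<close> U dA dC A0 X0 X Xr vpos v2 that in auto)
  \<comment> \<open>At positive times \<open>X t R > R\<close>, so only the vanishing of
    \<open>\<Gamma>\<close> is possible, and the factor \<open>v R t > 0\<close> cancels.\<close>
  have "(\<exists>t\<^sub>c. 0 < t\<^sub>c \<and> ereal t\<^sub>c \<le> T R \<and>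
            (X t\<^sub>c R = 0 \<or> ((\<lambda>r. X t\<^sub>c r) has_real_derivative 0) (at R)))
      \<longleftrightarrow> (\<exists>x>R. G x = 0)"
  proof
    assume "\<exists>t\<^sub>c. 0 < t\<^sub>c \<and> ereal t\<^sub>c \<le> T R \<and>
            (X t\<^sub>c R = 0 \<or> ((\<lambda>r. X t\<^sub>c r) has_real_derivative 0) (at R))"
    then obtain t where t: "0 < t" "X t R = 0 \<or> ((\<lambda>r. X t r) has_real_derivative 0) (at R)"
      by blast
    have "R < X t R"
      using Xlow[OF U(2), of t] t(1) mult_pos_pos[OF \<open>0 < v0 R\<close> t(1)] by linarith
    moreover from this have "((\<lambda>r. X t r) has_real_derivative 0) (at R)"
      using t(2) \<open>0 < R\<close> by auto
    then have "v R t * G (X t R) = 0"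
      using DERIV_unique[OF \<Gamma>] t(1) by simp
    ultimately show "\<exists>x>R. G x = 0" using vpos[OF U(2), of t] t(1) by auto
  next
    assume "\<exists>x>R. G x = 0"
    then obtain x where x: "R < x" "G x = 0" by blast
    \<comment> \<open>The time at which the linear lower bound for \<open>X t R\<close> reaches
      \<open>x\<close>; the curve itself must have passed through \<open>x\<close> by then.\<close>
    define b where "b = (x - R) / v0 R"
    have b: "0 \<le> b" "R + v0 R * b = x" using x(1) \<open>0 < v0 R\<close> by (simp_all add: b_def)
    have "continuous_on {0..} (\<lambda>t. X t R)"
      using X[OF U(2)] by (intro DERIV_continuous_on) auto
    then have "continuous_on {0..b} (\<lambda>t. X t R)"
      by (rule continuous_on_subset) auto
    then obtain t where t: "0 \<le> t" "X t R = x"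
      using IVT'[of "\<lambda>t. X t R" 0 x b] Xlow[OF U(2) b(1)] X0[OF U(2)] x(1) b by auto
    have "t \<noteq> 0" using t X0[OF U(2)] x(1) by auto
    moreover have "((\<lambda>r. X t r) has_real_derivative 0) (at R)" using \<Gamma>[OF t(1)] t(2) x(2) by simp
    ultimately show "\<exists>t\<^sub>c. 0 < t\<^sub>c \<and> ereal t\<^sub>c \<le> T R \<and>
            (X t\<^sub>c R = 0 \<or> ((\<lambda>r. X t\<^sub>c r) has_real_derivative 0) (at R))"
      using t(1) Tinf[OF U(2)] by (intro exI[of _ t]) auto
  qed
  also have "\<dots> \<longleftrightarrow> dC R < 0
    \<or> (dC R = 0 \<and>
         ereal (1 / v0 R)
           - ereal (dA R / 2)
             * enn2ereal (\<integral>\<^sup>+y\<in>{R..}. ennreal ((1 / y ^ k) / (C R - A R / y ^ k) powr (3/2)) \<partial>lborel) < 0)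
    \<or> (0 < dC R \<and> dC R < dA R / R ^ k \<and> G ((dA R / dC R) powr (1 / real k)) \<le> 0)"
    unfolding G_def
    by (rule breakdown_criterion) (use \<open>0 < R\<close> \<open>0 < v0 R\<close> k A0 dA0 wR in auto)
  finally show ?thesis
    unfolding G_def k(2) k_def[symmetric] DERIV_imp_deriv[OF dC[OF \<open>0 < R\<close>]] DERIV_imp_deriv[OF dA[OF \<open>0 < R\<close>]]
    .
qed

end
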